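(* In the setting of the context, let $\Phi\in\Omega^1(E,TE)$ be the connection form of the natural connection on the equilibrium bundle $(E,\pi,\Lambda)$, and endow $E$ with the Riemannian metric $$g(X,Y)=\langle\Phi(X),\Phi(Y)\rangle_1+\langle\pi_*(X-\Phi(X)),\pi_*(Y-\Phi(Y))\rangle_2,$$ where $\langle\cdot,\cdot\rangle_1$ and $\langle\cdot,\cdot\rangle_2$ denote the standard inner products on $\mathbb{R}^m\times\mathbb{R}^n$ and on $\mathbb{R}^m$ respectively. Then $\pi:E\to\Lambda$ is a Riemannian submersion (with $\Lambda\subset\mathbb{R}^m$ carrying the standard metric): for each $u\in E$, $H_u$ is the $g$-orthogonal complement of $V_u$ in $T_uE$ and $\pi_*:H_u\to T_{\pi(u)}\Lambda$ is an isometry. Therefore the natural connection coincides with the connection defined by $\pi$ as a Riemannian submersion.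
   Context: Setting. Let $n,m,k>0$ be integers. $\Lambda\subset\mathbb{R}^m$ is a connected open set. $V\subset\mathbb{R}^n$ is a compact submanifold of codimension zero whose boundary $\partial V$ is a stratified manifold. $M=\Lambda\times V$, and $f:M\to\mathbb{R}^n$ is a real analytic map, regarded as a family of vector fields $f(\lambda,\cdot)$ on $V$ defining the systems $\dot x=f(\lambda,x)$. The system stays inside $V$: on $\partial V$ the vector field either points inward or is tangent to $\partial V$. There are $k$ smooth functions $h_1,\dots,h_k:\mathbb{R}^n\to\mathbb{R}$, not depending on $\lambda$, which are first integrals (for each $\lambda\in\Lambda$ each $h_l$ is constant along every solution $x(t)$ in $V$ of $\dot x=f(\lambda,x)$) and are independent, i.e. their gradients $\nabla h_1,\dots,\nabla h_k$ are linearly independent at every point. The equilibrium locus is $E=\{(\lambda,x)\in M: f(\lambda,x)=0\}$, assumed nonempty; it is a smooth real analytic variety of dimension $m+k$. Non-degeneracy conditions (assumed). i) The rank of the matrix $\frac{\partial f}{\partial\lambda}$ is constant equal to $\min(m,n-k)$. ii) The rank of the matrix $\frac{\partial f}{\partial x}$ is constant equal to $n-k$ for $(\lambda,x)\in E$, and equals $n-p(\lambda,x)$ at points $(\lambda,x)\notin E$, where $p(\lambda,x)\le k$. iii) For every $(\lambda,x)\in E$, $\ker\left(\frac{\partial f}{\partial x}(\lambda,x)\right)\oplus\operatorname{im}\left(\frac{\partial f}{\partial x}(\lambda,x)\right)=\mathbb{R}^n$. Let $\pi:E\to\Lambda$, $\pi(\lambda,x)=\lambda$, assumed surjective; $(E,\pi,\Lambda)$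 is a fiber bundle, called the equilibrium bundle. Let $\pi':E\to\mathbb{R}^n$, $\pi'(\lambda,x)=x$, and $h=(h_1,\dots,h_k)$. The natural connection is the Ehresmann connection on $E$ whose horizontal space at $u=(\lambda,x)\in E$ is $H_u=T_u\big((h\circ\pi')^{-1}(h(x))\big)$; it satisfies $T_uE=V_u\oplus H_u$ with vertical space $V_u=\ker(\pi_{*,u})$. Its connection form $\Phi$ is, at each $u\in E$, the projection $\Phi_u:T_uE\to T_uE$ onto $V_u$ with kernel $H_u$. The connection defined by a Riemannian submersion is the one whose horizontal spaces are the orthogonal complements of the vertical spaces. *)

theory Defs
  imports "HOL-Analysis.Analysis"
begin

section \<open>Smooth and real analytic maps\<close>

text \<open>Meant for open \<open>S\<close>: the derivatives are taken in the ambient space.\<close>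

fun higher_differentiable_on ::
  "'a::euclidean_space set \<Rightarrow> ('a \<Rightarrow> 'b::euclidean_space) \<Rightarrow> nat \<Rightarrow> bool" where
  "higher_differentiable_on S f 0 \<longleftrightarrow> continuous_on S f"
| "higher_differentiable_on S f (Suc r) \<longleftrightarrow>
     (\<forall>x\<in>S. f differentiable (at x)) \<and>
     (\<forall>v. higher_differentiable_on S (\<lambda>x. frechet_derivative f (at x) v) r)"

definition smooth_on :: "'a::euclidean_space set \<Rightarrow> ('a \<Rightarrow> 'b::euclidean_space) \<Rightarrow> bool" where
  "smooth_on S f \<longleftrightarrow> (\<forall>r. higher_differentiable_on S f r)"

text \<open>
  Smooth maps on an arbitrary subset of a Euclidean space: those that extend locally to smooth
  maps on open sets.
\<close>

definition smooth_map_on :: "'a::euclidean_space set \<Rightarrow> ('a \<Rightarrow> 'b::euclidean_space) \<Rightarrow> bool" where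
  "smooth_map_on S f \<longleftrightarrow>
     (\<forall>u\<in>S. \<exists>W F. open W \<and> u \<in> W \<and> smooth_on W F \<and> (\<forall>p\<in>S \<inter> W. F p = f p))"

definition diffeomorphism ::
  "'a::euclidean_space set \<Rightarrow> 'b::euclidean_space set \<Rightarrow> ('a \<Rightarrow> 'b) \<Rightarrow> ('b \<Rightarrow> 'a) \<Rightarrow> bool" where
  "diffeomorphism S T F G \<longleftrightarrow>
     homeomorphism S T F G \<and> smooth_map_on S F \<and> smooth_map_on T G"

text \<open>
  A smooth map given near each point of \<open>S\<close> by a convergent power series, summed over the
  multi-indices \<open>\<alpha> : Basis \<rightarrow> \<nat>\<close>. As for \<open>analytic_on\<close> in the library, \<open>S\<close> need not be
  open and the expansion holds on a full neighbourhood of each point of \<open>S\<close>.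
\<close>

definition real_analytic_on :: "'a::euclidean_space set \<Rightarrow> ('a \<Rightarrow> 'b::euclidean_space) \<Rightarrow> bool" where
  "real_analytic_on S f \<longleftrightarrow>
     (\<forall>a\<in>S. \<exists>r>0. smooth_on (ball a r) f \<and>
        (\<exists>c. \<forall>x\<in>ball a r.
           ((\<lambda>\<alpha>. (\<Prod>b\<in>Basis. ((x - a) \<bullet> b) ^ \<alpha> b) *\<^sub>R c \<alpha>) has_sum f x)
             (Basis \<rightarrow>\<^sub>E (UNIV :: nat set))))"

definition gradient :: "(real^'n \<Rightarrow> real) \<Rightarrow> real^'n \<Rightarrow> real^'n" where
  "gradient \<phi> x = (\<chi> i. frechet_derivative \<phi> (at x) (axis i 1))"


section \<open>Submanifolds of Euclidean spaces\<close>

text \<open>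
  Embedded submanifolds without boundary, by slice charts; the regularity class \<open>reg\<close> is
  \<open>smooth_on\<close> or \<open>real_analytic_on\<close>.
\<close>

definition embedded_submanifold ::
  "('a set \<Rightarrow> ('a \<Rightarrow> 'a) \<Rightarrow> bool) \<Rightarrow> nat \<Rightarrow> 'a::euclidean_space set \<Rightarrow> bool" where
  "embedded_submanifold reg d S \<longleftrightarrow>
     (\<forall>u\<in>S. \<exists>W W' F G L. open W \<and> u \<in> W \<and> open W' \<and> homeomorphism W W' F G \<and>
        reg W F \<and> reg W' G \<and> subspace L \<and> dim L = d \<and> F ` (S \<inter> W) = L \<inter> W')"

text \<open>
  Nonsingular real analytic varieties of dimension \<open>d\<close>, possibly with boundary: locally a part of
  a \<open>d\<close>-dimensional analytic submanifold \<open>N\<close> that lies in the closure of its interior relative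
  to \<open>N\<close>. A boundary has to be allowed: the fibres of the equilibrium bundle are compact and are
  mapped by \<open>h\<close> locally diffeomorphically to \<open>\<real>\<^sup>k\<close>, which is impossible for nonempty closed
  manifolds of dimension \<open>k > 0\<close>.
\<close>

definition smooth_analytic_variety :: "nat \<Rightarrow> 'a::euclidean_space set \<Rightarrow> bool" where
  "smooth_analytic_variety d E \<longleftrightarrow>
     (\<forall>u\<in>E. \<exists>W N. open W \<and> u \<in> W \<and> embedded_submanifold real_analytic_on d N \<and>
        E \<inter> W \<subseteq> N \<and> E \<inter> W \<subseteq> closure (top_of_set N interior_of E))"

text \<open>
  A manifold with boundary of the dimension of the ambient space. It is only locally homeomorphic
  to a half-space, since its boundary may have corners. By invariance of domain the boundary of
  the manifold is its topological frontier.
\<close>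

definition codim_zero_submanifold :: "'a::euclidean_space set \<Rightarrow> bool" where
  "codim_zero_submanifold V \<longleftrightarrow>
     (\<forall>x\<in>V. \<exists>b\<in>Basis. \<exists>U Y. openin (top_of_set V) U \<and> x \<in> U \<and>
        openin (top_of_set {y::'a. 0 \<le> y \<bullet> b}) Y \<and> U homeomorphic Y)"

text \<open>
  A finite partition into smooth submanifolds satisfying the condition of the frontier. It is only
  used for compact sets, where locally finite partitions are finite.
\<close>

definition stratified_manifold :: "'a::euclidean_space set \<Rightarrow> bool" where
  "stratified_manifold X \<longleftrightarrow>
     (\<exists>\<S>. finite \<S> \<and> \<Union>\<S> = X \<and> pairwise disjnt \<S> \<and>
        (\<forall>S\<in>\<S>. S \<noteq> {} \<and> (\<exists>d. embedded_submanifold smooth_on d S)) \<and>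
        (\<forall>S\<in>\<S>. \<forall>T\<in>\<S>. S \<inter> closure T \<noteq> {} \<longrightarrow> S \<subseteq> closure T))"

text \<open>
  The derivations at \<open>u\<close> of the germs of smooth functions on \<open>S\<close>: the vectors annihilated by the
  differentials at \<open>u\<close> of all smooth functions that vanish on \<open>S\<close> near \<open>u\<close>. On a submanifold these
  are the velocities of curves in \<open>S\<close>; at a boundary point one gets the full tangent space, not
  only the vectors that are tangent to the boundary or point into \<open>S\<close>.
\<close>

definition tangent_space :: "'a::euclidean_space set \<Rightarrow> 'a \<Rightarrow> 'a set" where
  "tangent_space S u =
     {v. \<forall>W \<phi>. open W \<and> u \<in> W \<and> smooth_on W (\<phi> :: 'a \<Rightarrow> real) \<and> (\<forall>p\<in>S \<inter> W. \<phi> p = 0)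
           \<longrightarrow> frechet_derivative \<phi> (at u) v = 0}"

definition smooth_vector_field :: "'a::euclidean_space set \<Rightarrow> ('a \<Rightarrow> 'a) \<Rightarrow> bool" where
  "smooth_vector_field S X \<longleftrightarrow> smooth_map_on S X \<and> (\<forall>u\<in>S. X u \<in> tangent_space S u)"

definition points_inward_or_tangent :: "'a::euclidean_space set \<Rightarrow> 'a \<Rightarrow> 'a \<Rightarrow> bool" where
  "points_inward_or_tangent V x v \<longleftrightarrow>
     (\<exists>\<gamma> e. e > 0 \<and> \<gamma> 0 = x \<and> (\<forall>t\<in>{0..<e}. \<gamma> t \<in> V) \<and>
        (\<gamma> has_vector_derivative v) (at 0 within {0..<e}))"

definition direct_sum_decomposition :: "'a::real_vector set \<Rightarrow> 'a set \<Rightarrow> 'a set \<Rightarrow> bool" where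
  "direct_sum_decomposition T A B \<longleftrightarrow> A \<inter> B = {0} \<and> {a + b | a b. a \<in> A \<and> b \<in> B} = T"


section \<open>Bundles, connections and Riemannian submersions\<close>

definition fiber_bundle ::
  "'a::euclidean_space set \<Rightarrow> ('a \<Rightarrow> 'b::euclidean_space) \<Rightarrow> 'b set \<Rightarrow> 'c::euclidean_space set \<Rightarrow> bool"
  where
  "fiber_bundle E p B F \<longleftrightarrow>
     smooth_map_on E p \<and> p ` E = B \<and>
     (\<forall>b\<in>B. \<exists>U \<psi> \<psi>'. openin (top_of_set B) U \<and> b \<in> U \<and>
        diffeomorphism (E \<inter> p -` U) (U \<times> F) \<psi> \<psi>' \<and> (\<forall>u\<in>E \<inter> p -` U. fst (\<psi> u) = p u))"

text \<open>
  The maps \<open>p\<close> below are restrictions of differentiable maps of the ambient space, so their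
  differentials are restrictions of the Frechet derivative.
\<close>

definition vertical_space ::
  "'a::euclidean_space set \<Rightarrow> ('a \<Rightarrow> 'b::euclidean_space) \<Rightarrow> 'a \<Rightarrow> 'a set" where
  "vertical_space E p u = {X \<in> tangent_space E u. frechet_derivative p (at u) X = 0}"

definition linear_within :: "'a::real_vector set \<Rightarrow> ('a \<Rightarrow> 'b::real_vector) \<Rightarrow> bool" where
  "linear_within T A \<longleftrightarrow>
     (\<forall>X\<in>T. \<forall>Y\<in>T. A (X + Y) = A X + A Y) \<and> (\<forall>c. \<forall>X\<in>T. A (c *\<^sub>R X) = c *\<^sub>R A X)"

text \<open>\<open>\<Omega>\<^sup>1(E, TE)\<close>\<close>

definition tangent_valued_one_form :: "'a::euclidean_space set \<Rightarrow> ('a \<Rightarrow> 'a \<Rightarrow> 'a) \<Rightarrow> bool" where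
  "tangent_valued_one_form E \<Phi> \<longleftrightarrow>
     (\<forall>u\<in>E. linear_within (tangent_space E u) (\<Phi> u) \<and>
            \<Phi> u ` tangent_space E u \<subseteq> tangent_space E u) \<and>
     (\<forall>X. smooth_vector_field E X \<longrightarrow> smooth_map_on E (\<lambda>u. \<Phi> u (X u)))"

text \<open>An Ehresmann connection is given by its horizontal spaces \<open>H u\<close>.\<close>

definition connection_form ::
  "'a::euclidean_space set \<Rightarrow> ('a \<Rightarrow> 'b::euclidean_space) \<Rightarrow> ('a \<Rightarrow> 'a set) \<Rightarrow> ('a \<Rightarrow> 'a \<Rightarrow> 'a) \<Rightarrow> bool"
  where
  "connection_form E p H \<Phi> \<longleftrightarrow>
     tangent_valued_one_form E \<Phi> \<and>
     (\<forall>u\<in>E. \<Phi> u ` tangent_space E u \<subseteq> vertical_space E p u \<and>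
            (\<forall>X\<in>vertical_space E p u. \<Phi> u X = X) \<and>
            {X \<in> tangent_space E u. \<Phi> u X = 0} = H u)"

definition riemannian_metric :: "'a::euclidean_space set \<Rightarrow> ('a \<Rightarrow> 'a \<Rightarrow> 'a \<Rightarrow> real) \<Rightarrow> bool" where
  "riemannian_metric S g \<longleftrightarrow>
     (\<forall>u\<in>S. (\<forall>X\<in>tangent_space S u. linear_within (tangent_space S u) (g u X)) \<and>
            (\<forall>X\<in>tangent_space S u. \<forall>Y\<in>tangent_space S u. g u X Y = g u Y X) \<and>
            (\<forall>X\<in>tangent_space S u. X \<noteq> 0 \<longrightarrow> g u X X > 0)) \<and>
     (\<forall>X Y. smooth_vector_field S X \<and> smooth_vector_field S Y \<longrightarrow>
            smooth_map_on S (\<lambda>u. g u (X u) (Y u)))"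

definition metric_complement ::
  "'a::euclidean_space set \<Rightarrow> ('a \<Rightarrow> 'a \<Rightarrow> 'a \<Rightarrow> real) \<Rightarrow> 'a \<Rightarrow> 'a set \<Rightarrow> 'a set" where
  "metric_complement E g u A = {X \<in> tangent_space E u. \<forall>Y\<in>A. g u X Y = 0}"

definition linear_isometry_between ::
  "'a::real_vector set \<Rightarrow> ('a \<Rightarrow> 'a \<Rightarrow> real) \<Rightarrow> 'b::real_vector set \<Rightarrow> ('b \<Rightarrow> 'b \<Rightarrow> real) \<Rightarrow>
   ('a \<Rightarrow> 'b) \<Rightarrow> bool" where
  "linear_isometry_between A gA B gB L \<longleftrightarrow>
     linear_within A L \<and> bij_betw L A B \<and> (\<forall>X\<in>A. \<forall>Y\<in>A. gB (L X) (L Y) = gA X Y)"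

definition submersion_connection ::
  "'a::euclidean_space set \<Rightarrow> ('a \<Rightarrow> 'a \<Rightarrow> 'a \<Rightarrow> real) \<Rightarrow> ('a \<Rightarrow> 'b::euclidean_space) \<Rightarrow> 'a \<Rightarrow> 'a set"
  where
  "submersion_connection E g p u = metric_complement E g u (vertical_space E p u)"

definition riemannian_submersion ::
  "'a::euclidean_space set \<Rightarrow> ('a \<Rightarrow> 'a \<Rightarrow> 'a \<Rightarrow> real) \<Rightarrow>
   'b::euclidean_space set \<Rightarrow> ('b \<Rightarrow> 'b \<Rightarrow> 'b \<Rightarrow> real) \<Rightarrow> ('a \<Rightarrow> 'b) \<Rightarrow> bool" where
  "riemannian_submersion E g B gB p \<longleftrightarrow>
     riemannian_metric E g \<and> riemannian_metric B gB \<and> smooth_map_on E p \<and> p ` E = B \<and>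
     (\<forall>u\<in>E. frechet_derivative p (at u) ` tangent_space E u = tangent_space B (p u) \<and>
            linear_isometry_between
              (metric_complement E g u (vertical_space E p u)) (g u)
              (tangent_space B (p u)) (gB (p u)) (frechet_derivative p (at u)))"

definition standard_metric :: "'a::euclidean_space \<Rightarrow> 'a \<Rightarrow> 'a \<Rightarrow> real" where
  "standard_metric u X Y = X \<bullet> Y"


section \<open>The equilibrium bundle\<close>

definition equilibrium_locus ::
  "(real^'m) set \<Rightarrow> (real^'n) set \<Rightarrow> ((real^'m) \<times> (real^'n) \<Rightarrow> real^'n) \<Rightarrow> ((real^'m) \<times> (real^'n)) set"
  where
  "equilibrium_locus \<Lambda> V f = {u \<in> \<Lambda> \<times> V. f u = 0}"

definition jacobian_param ::
  "((real^'m) \<times> (real^'n) \<Rightarrow> real^'n) \<Rightarrow> (real^'m) \<times> (real^'n) \<Rightarrow> real^'m^'n" where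
  "jacobian_param f u = jacobian (\<lambda>l. f (l, snd u)) (at (fst u))"

definition jacobian_state ::
  "((real^'m) \<times> (real^'n) \<Rightarrow> real^'n) \<Rightarrow> (real^'m) \<times> (real^'n) \<Rightarrow> real^'n^'n" where
  "jacobian_state f u = jacobian (\<lambda>y. f (fst u, y)) (at (snd u))"

definition solution_in ::
  "(real^'n \<Rightarrow> real^'n) \<Rightarrow> (real^'n) set \<Rightarrow> real set \<Rightarrow> (real \<Rightarrow> real^'n) \<Rightarrow> bool" where
  "solution_in F V I x \<longleftrightarrow>
     is_interval I \<and> (\<forall>t\<in>I. x t \<in> V \<and> (x has_vector_derivative F (x t)) (at t within I))"

text \<open>
  The total function \<open>f\<close> represents the analytic map on \<open>\<Lambda> \<times> V\<close>. Its derivatives at points of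
  \<open>\<Lambda> \<times> frontier V\<close> are those of an analytic extension and do not depend on the extension, because
  \<open>V\<close> is the closure of its interior.
\<close>

locale equilibrium_bundle =
  fixes \<Lambda> :: "(real^'m) set"
    and V :: "(real^'n) set"
    and f :: "(real^'m) \<times> (real^'n) \<Rightarrow> real^'n"
    and h :: "'k::finite \<Rightarrow> real^'n \<Rightarrow> real"
  assumes open_param: "open \<Lambda>"
    and connected_param: "connected \<Lambda>"
    and compact_state: "compact V"
    and submanifold_state: "codim_zero_submanifold V"
    and stratified_boundary: "stratified_manifold (frontier V)"
    and analytic_f: "real_analytic_on (\<Lambda> \<times> V) f"
    and stays_inside:
      "\<And>l x. l \<in> \<Lambda> \<Longrightarrow> x \<in> frontier V \<Longrightarrow> points_inward_or_tangent V x (f (l, x))"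
    and smooth_h: "\<And>i. smooth_on UNIV (h i)"
    and first_integral:
      "\<And>i l I x s t. l \<in> \<Lambda> \<Longrightarrow> solution_in (\<lambda>y. f (l, y)) V I x \<Longrightarrow> s \<in> I \<Longrightarrow> t \<in> I \<Longrightarrow>
         h i (x s) = h i (x t)"
    and independent_integrals:
      "\<And>x. inj (\<lambda>i. gradient (h i) x) \<and> independent (range (\<lambda>i. gradient (h i) x))"
    and locus_nonempty: "equilibrium_locus \<Lambda> V f \<noteq> {}"
    and locus_variety: "smooth_analytic_variety (CARD('m) + CARD('k)) (equilibrium_locus \<Lambda> V f)"
    and rank_param:
      "\<And>u. u \<in> \<Lambda> \<times> V \<Longrightarrow> rank (jacobian_param f u) = min CARD('m) (CARD('n) - CARD('k))"
    and rank_state_locus: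
      "\<And>u. u \<in> equilibrium_locus \<Lambda> V f \<Longrightarrow> rank (jacobian_state f u) = CARD('n) - CARD('k)"
    and rank_state_off_locus:
      "\<And>u. u \<in> \<Lambda> \<times> V - equilibrium_locus \<Lambda> V f \<Longrightarrow>
         \<exists>p\<le>CARD('k). rank (jacobian_state f u) = CARD('n) - p"
    and kernel_image:
      "\<And>u. u \<in> equilibrium_locus \<Lambda> V f \<Longrightarrow>
         direct_sum_decomposition UNIV {v. jacobian_state f u *v v = 0}
           (range (\<lambda>v. jacobian_state f u *v v))"
    and proj_surj: "fst ` equilibrium_locus \<Lambda> V f = \<Lambda>"
    and locally_trivial: "\<exists>F :: (real^'n) set. fiber_bundle (equilibrium_locus \<Lambda> V f) fst \<Lambda> F"

text \<open>The horizontal space at \<open>u\<close> is tangent to the level set of \<open>h \<circ> \<pi>'\<close> in \<open>E\<close> through \<open>u\<close>.\<close>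

definition natural_connection ::
  "((real^'m) \<times> (real^'n)) set \<Rightarrow> ('k \<Rightarrow> real^'n \<Rightarrow> real) \<Rightarrow>
   (real^'m) \<times> (real^'n) \<Rightarrow> ((real^'m) \<times> (real^'n)) set" where
  "natural_connection E h u = tangent_space {q \<in> E. \<forall>i. h i (snd q) = h i (snd u)} u"

definition connection_metric ::
  "('a::euclidean_space \<Rightarrow> 'b::euclidean_space) \<Rightarrow> ('a \<Rightarrow> 'a \<Rightarrow> 'a) \<Rightarrow> 'a \<Rightarrow> 'a \<Rightarrow> 'a \<Rightarrow> real" where
  "connection_metric p \<Phi> u X Y =
     \<Phi> u X \<bullet> \<Phi> u Y +
     frechet_derivative p (at u) (X - \<Phi> u X) \<bullet> frechet_derivative p (at u) (Y - \<Phi> u Y)"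

end

theory Submission
  imports Defs
begin

text \<open>
  At each point \<open>u\<close> of \<open>E\<close> the form \<open>\<Phi>\<close> is a linear projection of \<open>T\<^sub>uE\<close> onto the vertical space
  with kernel \<open>H\<^sub>u\<close>. Pairing \<open>X\<close> with a vertical vector \<open>Y\<close> in the metric gives \<open>\<Phi> X \<bullet> Y\<close>, because
  \<open>Y - \<Phi> Y = 0\<close>; testing with \<open>Y = \<Phi> X\<close> shows that the complement of the vertical space is exactly
  \<open>ker \<Phi> = H\<^sub>u\<close> (\<open>metric_complement_vertical\<close>). On \<open>H\<^sub>u\<close> the first summand of the metric vanishes and
  the second one is the inner product of the projected vectors, so \<open>\<pi>\<^sub>*\<close> preserves inner products
  there (\<open>isometry_horizontal\<close>). The metric is definite because a vector killed by
  both summands is vertical and annihilated by \<open>\<Phi>\<close>, which is the identity on vertical vectors.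

  What the pointwise algebra does not give is that \<open>\<pi>\<^sub>*\<close> maps \<open>T\<^sub>uE\<close> \<^emph>\<open>onto\<close> \<open>\<real>\<^sup>m\<close>. This uses local
  triviality: freezing the fibre coordinate in a trivialisation gives a smooth local section through
  \<open>u\<close>, and the differential of a section is a right inverse of \<open>\<pi>\<^sub>*\<close> with values in
  \<open>T\<^sub>uE\<close> (\<open>fiber_bundle_differential_onto\<close>). Smoothness of the metric on smooth vector fields reduces
  to the closure of smooth maps under sums, linear maps and bilinear products. All this
  is done for a bounded linear bundle projection \<open>p\<close>, which is its own differential.
\<close>

section \<open>Calculus of smooth maps\<close>

lemma higher_differentiable_on_subset:
  assumes "higher_differentiable_on S f r" "T \<subseteq> S"
  shows "higher_differentiable_on T f r"
  using assms
proof (induction r arbitrary: f)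
  case 0
  then show ?case by (auto intro: continuous_on_subset)
next
  case (Suc r)
  then show ?case by auto
qed

lemma smooth_on_subset: "smooth_on S f \<Longrightarrow> T \<subseteq> S \<Longrightarrow> smooth_on T f"
  unfolding smooth_on_def using higher_differentiable_on_subset by blast

lemma higher_differentiable_on_lower:
  assumes "higher_differentiable_on S f (Suc r)"
  shows "higher_differentiable_on S f r"
  using assms
proof (induction r arbitrary: f)
  case 0
  then show ?case
    by (auto intro!: continuous_at_imp_continuous_on differentiable_imp_continuous_within)
next
  case (Suc r)
  have "\<forall>v. higher_differentiable_on S (\<lambda>x. frechet_derivative f (at x) v) (Suc r)"
    using Suc.prems by (subst (asm) higher_differentiable_on.simps(2)) blast
  with Suc.IH have "\<forall>v. higher_differentiable_on S (\<lambda>x. frechet_derivative f (at x) v) r"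
    by blast
  with Suc.prems show ?case by simp
qed

text \<open>
  Openness matters: the derivatives in the definition are taken in the ambient space and so depend
  on the values of the function in a full neighbourhood.
\<close>

lemma higher_differentiable_on_cong:
  assumes "higher_differentiable_on S f r" "open S" "\<And>x. x \<in> S \<Longrightarrow> f x = g x"
  shows "higher_differentiable_on S g r"
  using assms
proof (induction r arbitrary: f g)
  case 0
  then show ?case by (auto cong: continuous_on_cong)
next
  case (Suc r)
  have d: "(g has_derivative frechet_derivative f (at x)) (at x)" if "x \<in> S" for x
    using Suc.prems that
    by (auto simp: frechet_derivative_works intro: has_derivative_transform_within_open)
  have "higher_differentiable_on S (\<lambda>x. frechet_derivative g (at x) v) r" for v
  proof (rule Suc.IH[OF _ \<open>open S\<close>])
    show "higher_differentiable_on S (\<lambda>x. frechet_derivative f (at x) v) r"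
      using Suc.prems by simp
    show "frechet_derivative f (at x) v = frechet_derivative g (at x) v" if "x \<in> S" for x
      using frechet_derivative_at[OF d[OF that]] by simp
  qed
  with d show ?case by (auto simp: differentiable_def)
qed

text \<open>
  The derivative may be supplied by a formula that is valid only on the open set; this is how the
  inductive steps below apply the rules of differentiation.
\<close>

lemma higher_differentiable_on_SucI:
  assumes "open S"
    and "\<And>x. x \<in> S \<Longrightarrow> (f has_derivative f' x) (at x)"
    and "\<And>v. higher_differentiable_on S (\<lambda>x. f' x v) r"
  shows "higher_differentiable_on S f (Suc r)"
proof -
  have "higher_differentiable_on S (\<lambda>x. frechet_derivative f (at x) v) r" for v
    by (rule higher_differentiable_on_cong[OF assms(3)[of v] assms(1)])
      (simp add: frechet_derivative_at[OF assms(2), symmetric])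
  with assms(2) show ?thesis by (auto simp: differentiable_def)
qed

lemma higher_differentiable_on_has_derivative:
  assumes "higher_differentiable_on S f (Suc r)" "x \<in> S"
  shows "(f has_derivative frechet_derivative f (at x)) (at x)"
  using assms by (simp add: frechet_derivative_works)

lemma higher_differentiable_on_add:
  assumes "open S" "higher_differentiable_on S f r" "higher_differentiable_on S g r"
  shows "higher_differentiable_on S (\<lambda>x. f x + g x) r"
  using assms
proof (induction r arbitrary: f g)
  case 0
  then show ?case by (auto intro: continuous_on_add)
next
  case (Suc r)
  show ?case
  proof (rule higher_differentiable_on_SucI[OF \<open>open S\<close>])
    show "((\<lambda>x. f x + g x) has_derivative
        (\<lambda>v. frechet_derivative f (at x) v + frechet_derivative g (at x) v)) (at x)" if "x \<in> S" for x
      using higher_differentiable_on_has_derivative[OF Suc.prems(2) that]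
        higher_differentiable_on_has_derivative[OF Suc.prems(3) that]
      by (rule has_derivative_add)
    show "higher_differentiable_on S
        (\<lambda>x. frechet_derivative f (at x) v + frechet_derivative g (at x) v) r" for v
      using Suc by simp
  qed
qed

lemma higher_differentiable_on_linear:
  assumes "bounded_linear L" "open S" "higher_differentiable_on S f r"
  shows "higher_differentiable_on S (\<lambda>x. L (f x)) r"
  using assms(3)
proof (induction r arbitrary: f)
  case 0
  then show ?case using bounded_linear.continuous_on[OF assms(1)] by auto
next
  case (Suc r)
  show ?case
  proof (rule higher_differentiable_on_SucI[OF \<open>open S\<close>])
    show "((\<lambda>x. L (f x)) has_derivative (\<lambda>v. L (frechet_derivative f (at x) v))) (at x)"
      if "x \<in> S" for x
      using bounded_linear.has_derivative[OF assms(1)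
          higher_differentiable_on_has_derivative[OF Suc.prems that]] .
    show "higher_differentiable_on S (\<lambda>x. L (frechet_derivative f (at x) v)) r" for v
      using Suc by simp
  qed
qed

lemma higher_differentiable_on_bilinear:
  assumes "bounded_bilinear B" "open S"
    and "higher_differentiable_on S f r" "higher_differentiable_on S g r"
  shows "higher_differentiable_on S (\<lambda>x. B (f x) (g x)) r"
  using assms(3,4)
proof (induction r arbitrary: f g)
  case 0
  then show ?case using bounded_bilinear.continuous_on[OF assms(1)] by auto
next
  case (Suc r)
  show ?case
  proof (rule higher_differentiable_on_SucI[OF \<open>open S\<close>])
    show "((\<lambda>x. B (f x) (g x)) has_derivative
        (\<lambda>v. B (f x) (frechet_derivative g (at x) v) + B (frechet_derivative f (at x) v) (g x))) (at x)"
      if "x \<in> S" for x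
      using bounded_bilinear.FDERIV[OF assms(1)
          higher_differentiable_on_has_derivative[OF Suc.prems(1) that]
          higher_differentiable_on_has_derivative[OF Suc.prems(2) that]] .
    show "higher_differentiable_on S
        (\<lambda>x. B (f x) (frechet_derivative g (at x) v) + B (frechet_derivative f (at x) v) (g x)) r" for v
    proof (rule higher_differentiable_on_add[OF \<open>open S\<close>]; rule Suc.IH)
      show "higher_differentiable_on S f r" "higher_differentiable_on S g r"
        using Suc.prems by (auto intro: higher_differentiable_on_lower simp del: higher_differentiable_on.simps)
      show "higher_differentiable_on S (\<lambda>x. frechet_derivative g (at x) v) r"
        "higher_differentiable_on S (\<lambda>x. frechet_derivative f (at x) v) r"
        using Suc.prems by simp_all
    qed
  qed
qed

lemma smooth_on_has_derivative:
  assumes "smooth_on W f" "u \<in> W"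
  shows "(f has_derivative frechet_derivative f (at u)) (at u)"
  using assms higher_differentiable_on_has_derivative[of W f 0 u] unfolding smooth_on_def by blast

text \<open>
  Two local extensions can be combined on the intersection of their domains; this reduces closure
  properties of smooth maps on arbitrary sets to open sets.
\<close>

lemma smooth_map_on_combine:
  fixes f :: "'a::euclidean_space \<Rightarrow> 'b::euclidean_space" and g :: "'a \<Rightarrow> 'c::euclidean_space"
    and B :: "'b \<Rightarrow> 'c \<Rightarrow> 'd::euclidean_space"
  assumes "\<And>(W :: 'a set) F G. open W \<Longrightarrow> smooth_on W F \<Longrightarrow> smooth_on W G \<Longrightarrow> smooth_on W (\<lambda>x. B (F x) (G x))"
    and "smooth_map_on S f" "smooth_map_on S g"
  shows "smooth_map_on S (\<lambda>x. B (f x) (g x))"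
  unfolding smooth_map_on_def
proof
  fix u assume "u \<in> S"
  obtain W F where F: "open W" "u \<in> W" "smooth_on W F" "\<forall>p\<in>S \<inter> W. F p = f p"
    using assms(2) \<open>u \<in> S\<close> unfolding smooth_map_on_def by blast
  obtain W' G where G: "open W'" "u \<in> W'" "smooth_on W' G" "\<forall>p\<in>S \<inter> W'. G p = g p"
    using assms(3) \<open>u \<in> S\<close> unfolding smooth_map_on_def by blast
  have "smooth_on (W \<inter> W') (\<lambda>x. B (F x) (G x))"
    using F(1,3) G(1,3) by (intro assms(1)) (auto intro: smooth_on_subset)
  moreover have "\<forall>p\<in>S \<inter> (W \<inter> W'). B (F p) (G p) = B (f p) (g p)"
    using F(4) G(4) by simp
  ultimately show "\<exists>W H. open W \<and> u \<in> W \<and> smooth_on W H \<and> (\<forall>p\<in>S \<inter> W. H p = B (f p) (g p))"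
    using F(1,2) G(1,2) by (intro exI[of _ "W \<inter> W'"] exI[of _ "\<lambda>x. B (F x) (G x)"]) auto
qed

lemma smooth_map_on_add:
  "smooth_map_on S f \<Longrightarrow> smooth_map_on S g \<Longrightarrow> smooth_map_on S (\<lambda>x. f x + g x)"
  by (rule smooth_map_on_combine) (auto simp: smooth_on_def intro: higher_differentiable_on_add)

lemma smooth_map_on_inner:
  "smooth_map_on S f \<Longrightarrow> smooth_map_on S g \<Longrightarrow> smooth_map_on S (\<lambda>x. f x \<bullet> g x)"
  by (rule smooth_map_on_combine)
    (auto simp: smooth_on_def intro: higher_differentiable_on_bilinear[OF bounded_bilinear_inner])

lemma smooth_map_on_linear:
  assumes "bounded_linear L" "smooth_map_on S f"
  shows "smooth_map_on S (\<lambda>x. L (f x))"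
  by (rule smooth_map_on_combine[where B = "\<lambda>a _. L a", OF _ assms(2) assms(2)])
    (auto simp: smooth_on_def intro: higher_differentiable_on_linear[OF assms(1)])

lemma smooth_map_on_diff:
  assumes "smooth_map_on S f" "smooth_map_on S g"
  shows "smooth_map_on S (\<lambda>x. f x - g x)"
  using smooth_map_on_add[OF assms(1) smooth_map_on_linear[OF bounded_linear_minus[OF bounded_linear_ident] assms(2)]]
  by simp


section \<open>Tangent spaces and local sections\<close>

lemma subspace_tangent_space:
  fixes S :: "'a::euclidean_space set"
  shows "subspace (tangent_space S u)"
proof -
  have lin: "linear (frechet_derivative \<phi> (at u))" if "smooth_on W \<phi>" "u \<in> W"
    for W and \<phi> :: "'a \<Rightarrow> real"
    using smooth_on_has_derivative[OF that] by (rule has_derivative_linear)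
  show ?thesis
  proof (rule subspaceI)
    show "0 \<in> tangent_space S u"
      unfolding tangent_space_def by (blast intro: linear_0[OF lin])
  next
    fix v w assume vw: "v \<in> tangent_space S u" "w \<in> tangent_space S u"
    show "v + w \<in> tangent_space S u"
      unfolding tangent_space_def
    proof (intro CollectI allI impI, elim conjE)
      fix W and \<phi> :: "'a \<Rightarrow> real"
      assume W: "open W" "u \<in> W" "smooth_on W \<phi>" "\<forall>p\<in>S \<inter> W. \<phi> p = 0"
      then have "frechet_derivative \<phi> (at u) v = 0" "frechet_derivative \<phi> (at u) w = 0"
        using vw unfolding tangent_space_def by blast+
      then show "frechet_derivative \<phi> (at u) (v + w) = 0"
        by (simp add: linear_add[OF lin[OF W(3,2)]])
    qed
  next
    fix c v assume v: "v \<in> tangent_space S u"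
    show "c *\<^sub>R v \<in> tangent_space S u"
      unfolding tangent_space_def
    proof (intro CollectI allI impI, elim conjE)
      fix W and \<phi> :: "'a \<Rightarrow> real"
      assume W: "open W" "u \<in> W" "smooth_on W \<phi>" "\<forall>p\<in>S \<inter> W. \<phi> p = 0"
      then have "frechet_derivative \<phi> (at u) v = 0"
        using v unfolding tangent_space_def by blast
      then show "frechet_derivative \<phi> (at u) (c *\<^sub>R v) = 0"
        by (simp add: linear_scale[OF lin[OF W(3,2)]])
    qed
  qed
qed

lemma tangent_space_open:
  assumes "open B" "b \<in> B"
  shows "tangent_space B b = UNIV"
proof -
  have "frechet_derivative \<phi> (at b) v = 0"
    if "open W" "b \<in> W" "\<forall>p\<in>B \<inter> W. \<phi> p = 0" for W and \<phi> :: "'a \<Rightarrow> real" and v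
  proof -
    have "(\<phi> has_derivative (\<lambda>_. 0)) (at b)"
      by (rule has_derivative_transform_within_open[of "\<lambda>_. 0" _ _ _ "B \<inter> W"]) (use assms that in auto)
    from frechet_derivative_at[OF this] show ?thesis by (simp add: fun_eq_iff)
  qed
  then show ?thesis unfolding tangent_space_def by blast
qed

text \<open>
  A smooth function that vanishes on \<open>S\<close> pulls back to zero near \<open>b\<close>, and the chain rule turns this
  into the defining condition of the tangent space.
\<close>

lemma differential_in_tangent_space:
  fixes s :: "'b::euclidean_space \<Rightarrow> 'a::euclidean_space"
  assumes "open U" "b \<in> U" "(s has_derivative s') (at b)" "\<And>l. l \<in> U \<Longrightarrow> s l \<in> S"
  shows "s' v \<in> tangent_space S (s b)"
  unfolding tangent_space_def
proof (intro CollectI allI impI, elim conjE)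
  fix W and \<phi> :: "'a \<Rightarrow> real"
  assume W: "open W" "s b \<in> W" "smooth_on W \<phi>" "\<forall>p\<in>S \<inter> W. \<phi> p = 0"
  have "(\<phi> \<circ> s has_derivative frechet_derivative \<phi> (at (s b)) \<circ> s') (at b)"
    by (rule diff_chain_at[OF assms(3) smooth_on_has_derivative[OF W(3,2)]])
  moreover have "(\<phi> \<circ> s has_derivative (\<lambda>_. 0)) (at b)"
  proof -
    have "isCont s b" using assms(3) by (rule has_derivative_continuous)
    then obtain A where A: "open A" "b \<in> A" "\<forall>l\<in>A. s l \<in> W"
      using W(1,2) unfolding continuous_at_open by blast
    show ?thesis
      by (rule has_derivative_transform_within_open[of "\<lambda>_. 0" _ _ _ "A \<inter> U"])
        (use A assms W(4) in auto)
  qed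
  ultimately have "frechet_derivative \<phi> (at (s b)) \<circ> s' = (\<lambda>_. 0)"
    by (rule has_derivative_unique)
  then show "frechet_derivative \<phi> (at (s b)) (s' v) = 0" by (simp add: fun_eq_iff)
qed

text \<open>
  With the fibre coordinate \<open>y\<close> of \<open>u\<close> frozen, \<open>l \<mapsto> \<psi>' (l, y)\<close> is a section. As \<open>\<psi>'\<close> is only given on
  \<open>U \<times> F\<close>, differentiability comes from a smooth extension \<open>G\<close>. Since \<open>B\<close> is open, the slice on
  which \<open>G\<close> and \<open>\<psi>'\<close> agree is a full neighbourhood of the base point.
\<close>

lemma fiber_bundle_local_section:
  assumes "fiber_bundle E p B F" "open B" "u \<in> E"
  obtains U s s' where "open U" "p u \<in> U" "s (p u) = u"
    "(s has_derivative s') (at (p u))" "\<And>l. l \<in> U \<Longrightarrow> s l \<in> E \<and> p (s l) = l"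
proof -
  have "p u \<in> B" using assms unfolding fiber_bundle_def by blast
  then obtain U \<psi> \<psi>' where U: "openin (top_of_set B) U" "p u \<in> U"
    and dif: "diffeomorphism (E \<inter> p -` U) (U \<times> F) \<psi> \<psi>'"
    and fst: "\<forall>w\<in>E \<inter> p -` U. fst (\<psi> w) = p w"
    using assms(1) unfolding fiber_bundle_def by blast
  have "open U" using U(1) assms(2) openin_open_eq by blast
  have hom: "homeomorphism (E \<inter> p -` U) (U \<times> F) \<psi> \<psi>'" and sm: "smooth_map_on (U \<times> F) \<psi>'"
    using dif unfolding diffeomorphism_def by auto
  have u: "u \<in> E \<inter> p -` U" using assms(3) U(2) by simp
  define y where "y = snd (\<psi> u)"
  have \<psi>u: "\<psi> u = (p u, y)" using fst u by (metis y_def prod.collapse)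
  have "\<psi> u \<in> U \<times> F" "\<psi>' (\<psi> u) = u"
    using hom u unfolding homeomorphism_def by blast+
  then have y: "y \<in> F" and \<psi>'u: "\<psi>' (p u, y) = u"
    unfolding \<psi>u by blast+
  obtain W G where G: "open W" "(p u, y) \<in> W" "smooth_on W G" "\<forall>q\<in>(U \<times> F) \<inter> W. G q = \<psi>' q"
    using sm U(2) y unfolding smooth_map_on_def by blast
  let ?A = "U \<inter> (\<lambda>l. (l, y)) -` W"
  have sec: "\<psi>' (l, y) \<in> E \<and> p (\<psi>' (l, y)) = l" if "l \<in> U" for l
  proof -
    have "(l, y) \<in> U \<times> F" using that y by simp
    then have "\<psi>' (l, y) \<in> E \<inter> p -` U" "\<psi> (\<psi>' (l, y)) = (l, y)"
      using hom unfolding homeomorphism_def by blast+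
    then show ?thesis using fst by (metis IntD1 fst_conv)
  qed
  have "open ?A"
    using \<open>open U\<close> G(1) by (intro open_Int open_vimage continuous_intros)
  have "((\<lambda>l. (l, y)) has_derivative (\<lambda>v. (v, 0))) (at (p u))"
    by (intro has_derivative_Pair has_derivative_ident has_derivative_const)
  from diff_chain_at[OF this smooth_on_has_derivative[OF G(3,2)]]
  have der: "((\<lambda>l. G (l, y)) has_derivative (\<lambda>v. frechet_derivative G (at (p u, y)) (v, 0))) (at (p u))"
    by (simp add: o_def)
  show thesis
  proof (rule that[of ?A "\<lambda>l. G (l, y)", OF \<open>open ?A\<close> _ _ der])
    show "p u \<in> ?A" using U(2) G(2) by simp
    show "G (p u, y) = u" using G(2,4) U(2) y \<psi>'u by simp
    show "G (l, y) \<in> E \<and> p (G (l, y)) = l" if "l \<in> ?A" for l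
      using that G(4) y sec by simp
  qed
qed

lemma frechet_derivative_bounded_linear:
  assumes "bounded_linear p"
  shows "frechet_derivative p (at u) = p"
  by (rule frechet_derivative_at[OF bounded_linear_imp_has_derivative[OF assms], symmetric])

text \<open>
  The differential of a local section is a right inverse of the projection, and its values are
  tangent to \<open>E\<close>.
\<close>

lemma fiber_bundle_differential_onto:
  assumes "fiber_bundle E p B F" "open B" "bounded_linear p" "u \<in> E"
  shows "p ` tangent_space E u = UNIV"
proof -
  obtain U s s' where U: "open U" "p u \<in> U" and su: "s (p u) = u"
    and der: "(s has_derivative s') (at (p u))"
    and sec: "\<And>l. l \<in> U \<Longrightarrow> s l \<in> E \<and> p (s l) = l"
    using fiber_bundle_local_section[OF assms(1,2,4)] by blast
  have "((\<lambda>l. p (s l)) has_derivative (\<lambda>v. p (s' v))) (at (p u))"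
    by (rule bounded_linear.has_derivative[OF assms(3) der])
  moreover have "((\<lambda>l. p (s l)) has_derivative (\<lambda>v. v)) (at (p u))"
    by (rule has_derivative_transform_within_open[OF has_derivative_ident U]) (simp add: sec)
  ultimately have "(\<lambda>v. p (s' v)) = (\<lambda>v. v)"
    by (rule has_derivative_unique)
  moreover have "s' v \<in> tangent_space E u" for v
    using differential_in_tangent_space[OF U der, of E v] sec su by auto
  ultimately have "v \<in> p ` tangent_space E u" for v
    by (intro image_eqI[of v p "s' v"]) (simp_all add: fun_eq_iff)
  then show ?thesis by blast
qed


section \<open>The connection form and its metric\<close>

lemma vertical_space_linear:
  assumes "bounded_linear p"
  shows "vertical_space E p u = {X \<in> tangent_space E u. p X = 0}"
  unfolding vertical_space_def frechet_derivative_bounded_linear[OF assms] ..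

lemma connection_metric_linear:
  assumes "bounded_linear p"
  shows "connection_metric p \<Phi> u X Y =
    \<Phi> u X \<bullet> \<Phi> u Y + p (X - \<Phi> u X) \<bullet> p (Y - \<Phi> u Y)"
  unfolding connection_metric_def frechet_derivative_bounded_linear[OF assms] ..

lemma connection_form_projection:
  assumes "connection_form E p H \<Phi>" "bounded_linear p" "u \<in> E" "X \<in> tangent_space E u"
  shows "\<Phi> u X \<in> tangent_space E u" "p (\<Phi> u X) = 0" "\<Phi> u (\<Phi> u X) = \<Phi> u X"
proof -
  have "\<Phi> u X \<in> vertical_space E p u" "\<forall>Y\<in>vertical_space E p u. \<Phi> u Y = Y"
    using assms(1,3,4) unfolding connection_form_def by blast+
  then show "\<Phi> u X \<in> tangent_space E u" "p (\<Phi> u X) = 0" "\<Phi> u (\<Phi> u X) = \<Phi> u X"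
    by (auto simp: vertical_space_linear[OF assms(2)])
qed

lemma connection_form_vertical:
  assumes "connection_form E p H \<Phi>" "bounded_linear p" "u \<in> E" "X \<in> tangent_space E u" "p X = 0"
  shows "\<Phi> u X = X"
  using assms unfolding connection_form_def by (auto simp: vertical_space_linear)

lemma connection_form_horizontal:
  assumes "connection_form E p H \<Phi>" "u \<in> E"
  shows "H u = {X \<in> tangent_space E u. \<Phi> u X = 0}"
  using assms unfolding connection_form_def by blast

lemma connection_form_linear:
  assumes "connection_form E p H \<Phi>" "u \<in> E"
  shows "linear_within (tangent_space E u) (\<Phi> u)"
  using assms unfolding connection_form_def tangent_valued_one_form_def by blast

lemma connection_form_remainder_horizontal:
  assumes "connection_form E p H \<Phi>" "bounded_linear p" "u \<in> E" "X \<in> tangent_space E u"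
  shows "X - \<Phi> u X \<in> H u"
proof -
  note lin = connection_form_linear[OF assms(1,3), unfolded linear_within_def]
  note \<Phi> = connection_form_projection[OF assms]
  have "\<Phi> u (X + (-1) *\<^sub>R \<Phi> u X) = \<Phi> u X + (-1) *\<^sub>R \<Phi> u (\<Phi> u X)"
    using lin assms(4) \<Phi>(1) subspace_scale[OF subspace_tangent_space \<Phi>(1)] by metis
  then show ?thesis
    using \<Phi> assms(4) subspace_diff[OF subspace_tangent_space]
    by (simp add: connection_form_horizontal[OF assms(1,3)])
qed

lemma riemannian_metric_standard: "riemannian_metric S standard_metric"
  unfolding riemannian_metric_def standard_metric_def linear_within_def smooth_vector_field_def
  by (auto simp: inner_add_right inner_commute intro: smooth_map_on_inner)

lemma riemannian_metric_connection_metric: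
  assumes con: "connection_form E p H \<Phi>" and p: "bounded_linear p"
  shows "riemannian_metric E (connection_metric p \<Phi>)"
  unfolding riemannian_metric_def connection_metric_linear[OF p]
proof (intro conjI ballI allI impI)
  interpret bounded_linear p by (fact p)
  fix u assume u: "u \<in> E"
  note lin = connection_form_linear[OF con u, unfolded linear_within_def]
  fix X assume X: "X \<in> tangent_space E u"
  show "linear_within (tangent_space E u)
      (\<lambda>Y. \<Phi> u X \<bullet> \<Phi> u Y + p (X - \<Phi> u X) \<bullet> p (Y - \<Phi> u Y))"
    using lin unfolding linear_within_def
    by (simp add: add diff scaleR inner_add_right inner_diff_right algebra_simps)
  show "\<Phi> u X \<bullet> \<Phi> u Y + p (X - \<Phi> u X) \<bullet> p (Y - \<Phi> u Y) =
        \<Phi> u Y \<bullet> \<Phi> u X + p (Y - \<Phi> u Y) \<bullet> p (X - \<Phi> u X)" for Y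
    by (simp add: inner_commute)
  assume "X \<noteq> 0"
  show "\<Phi> u X \<bullet> \<Phi> u X + p (X - \<Phi> u X) \<bullet> p (X - \<Phi> u X) > 0"
  proof (cases "\<Phi> u X = 0")
    case False
    then show ?thesis by (simp add: add_pos_nonneg)
  next
    case True
    then have "p X \<noteq> 0" using connection_form_vertical[OF con p u X] \<open>X \<noteq> 0\<close> by auto
    with True show ?thesis by simp
  qed
next
  fix X Y assume "smooth_vector_field E X \<and> smooth_vector_field E Y"
  then have "smooth_map_on E X" "smooth_map_on E Y"
    "smooth_map_on E (\<lambda>u. \<Phi> u (X u))" "smooth_map_on E (\<lambda>u. \<Phi> u (Y u))"
    using con unfolding connection_form_def tangent_valued_one_form_def smooth_vector_field_def
    by auto
  then show "smooth_map_on E (\<lambda>u. \<Phi> u (X u) \<bullet> \<Phi> u (Y u) +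
      p (X u - \<Phi> u (X u)) \<bullet> p (Y u - \<Phi> u (Y u)))"
    by (intro smooth_map_on_add smooth_map_on_inner smooth_map_on_linear[OF p] smooth_map_on_diff)
qed

text \<open>
  For vertical \<open>Y\<close> the metric reads \<open>\<Phi> X \<bullet> Y\<close>, and \<open>\<Phi> X\<close> is itself a vertical test vector, so
  orthogonality to all of them forces \<open>\<Phi> X = 0\<close>.
\<close>

lemma metric_complement_vertical:
  assumes con: "connection_form E p H \<Phi>" and p: "bounded_linear p" and u: "u \<in> E"
  shows "metric_complement E (connection_metric p \<Phi>) u (vertical_space E p u) = H u"
proof -
  interpret bounded_linear p by (fact p)
  have vert: "connection_metric p \<Phi> u X Y = \<Phi> u X \<bullet> Y" if "Y \<in> vertical_space E p u" for X Y
    using that connection_form_vertical[OF con p u, of Y]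
    by (auto simp: connection_metric_linear[OF p] vertical_space_linear[OF p] zero)
  have "(\<forall>Y\<in>vertical_space E p u. \<Phi> u X \<bullet> Y = 0) \<longleftrightarrow> \<Phi> u X = 0" if "X \<in> tangent_space E u" for X
  proof -
    have "\<Phi> u X \<in> vertical_space E p u"
      using connection_form_projection[OF con p u that] by (simp add: vertical_space_linear[OF p])
    then show ?thesis by (metis inner_eq_zero_iff inner_zero_left)
  qed
  then show ?thesis
    unfolding metric_complement_def connection_form_horizontal[OF con u] by (auto simp: vert)
qed

text \<open>
  Injectivity holds because a horizontal vector in the kernel of the projection is also vertical;
  for surjectivity, a preimage \<open>X\<close> can be replaced by its horizontal part \<open>X - \<Phi> X\<close>, which has the
  same projection.
\<close>

lemma isometry_horizontal:
  assumes con: "connection_form E p H \<Phi>" and p: "bounded_linear p" and u: "u \<in> E"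
    and onto: "p ` tangent_space E u = UNIV"
  shows "linear_isometry_between (H u) (connection_metric p \<Phi> u) UNIV (standard_metric (p u)) p"
  unfolding linear_isometry_between_def
proof (intro conjI ballI)
  interpret bounded_linear p by (fact p)
  note H = connection_form_horizontal[OF con u]
  show "linear_within (H u) p" unfolding linear_within_def by (simp add: add scaleR)
  show "standard_metric (p u) (p X) (p Y) = connection_metric p \<Phi> u X Y"
    if "X \<in> H u" "Y \<in> H u" for X Y
    using that by (simp add: H standard_metric_def connection_metric_linear[OF p])
  have "inj_on p (H u)"
  proof (rule inj_onI)
    fix X Y assume X: "X \<in> H u" and Y: "Y \<in> H u" and eq: "p X = p Y"
    have T: "X \<in> tangent_space E u" "Y \<in> tangent_space E u" "\<Phi> u X = 0" "\<Phi> u Y = 0"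
      using X Y by (simp_all add: H)
    have Y': "(-1) *\<^sub>R Y \<in> tangent_space E u"
      by (rule subspace_scale[OF subspace_tangent_space T(2)])
    note lin = connection_form_linear[OF con u, unfolded linear_within_def]
    have "\<Phi> u (X + (-1) *\<^sub>R Y) = \<Phi> u X + \<Phi> u ((-1) *\<^sub>R Y)"
      using lin T(1) Y' by blast
    moreover have "\<Phi> u ((-1) *\<^sub>R Y) = (-1) *\<^sub>R \<Phi> u Y"
      using lin T(2) by blast
    ultimately have "\<Phi> u (X - Y) = 0" using T(3,4) by simp
    moreover have "\<Phi> u (X - Y) = X - Y"
    proof (rule connection_form_vertical[OF con p u])
      show "X - Y \<in> tangent_space E u"
        by (rule subspace_diff[OF subspace_tangent_space T(1,2)])
      show "p (X - Y) = 0" using eq by (simp add: diff)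
    qed
    ultimately show "X = Y" by simp
  qed
  moreover have "p ` H u = UNIV"
  proof -
    have "v \<in> p ` H u" for v
    proof -
      have "v \<in> p ` tangent_space E u" unfolding onto by simp
      then obtain X where X: "X \<in> tangent_space E u" "p X = v" by (auto elim: imageE)
      have "p (X - \<Phi> u X) = v"
        using X connection_form_projection(2)[OF con p u X(1)] by (simp add: diff)
      with connection_form_remainder_horizontal[OF con p u X(1)] show ?thesis by (metis image_eqI)
    qed
    then show ?thesis by (simp add: set_eq_iff)
  qed
  ultimately show "bij_betw p (H u) UNIV" by (simp add: bij_betw_def)
qed


section \<open>The natural connection is a Riemannian submersion connection\<close>

theorem mainTheorem6:
  fixes \<Lambda> :: "(real^'m) set"
    and V :: "(real^'n) set"
    and f :: "(real^'m) \<times> (real^'n) \<Rightarrow> real^'n"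
    and h :: "'k::finite \<Rightarrow> real^'n \<Rightarrow> real"
    and \<Phi> :: "(real^'m) \<times> (real^'n) \<Rightarrow> (real^'m) \<times> (real^'n) \<Rightarrow> (real^'m) \<times> (real^'n)"
    and E :: "((real^'m) \<times> (real^'n)) set"
    and \<pi> :: "(real^'m) \<times> (real^'n) \<Rightarrow> real^'m"
    and g :: "(real^'m) \<times> (real^'n) \<Rightarrow> (real^'m) \<times> (real^'n) \<Rightarrow> (real^'m) \<times> (real^'n) \<Rightarrow> real"
  defines "E \<equiv> equilibrium_locus \<Lambda> V f"
    and "\<pi> \<equiv> fst"
    and "g \<equiv> connection_metric \<pi> \<Phi>"
  assumes "equilibrium_bundle \<Lambda> V f h"
    and "connection_form E \<pi> (natural_connection E h) \<Phi>"
  shows "riemannian_metric E g \<and>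
         riemannian_submersion E g \<Lambda> standard_metric \<pi> \<and>
         (\<forall>u\<in>E. natural_connection E h u = metric_complement E g u (vertical_space E \<pi> u) \<and>
            linear_isometry_between (natural_connection E h u) (g u)
              (tangent_space \<Lambda> (\<pi> u)) (standard_metric (\<pi> u)) (frechet_derivative \<pi> (at u))) \<and>
         (\<forall>u\<in>E. natural_connection E h u = submersion_connection E g \<pi> u)"
proof -
  interpret equilibrium_bundle \<Lambda> V f h by fact
  note con = assms(5)
  have p: "bounded_linear \<pi>" unfolding \<pi>_def by (rule bounded_linear_fst)
  have surj: "\<pi> ` E = \<Lambda>" using proj_surj unfolding E_def \<pi>_def .
  obtain F :: "(real^'n) set" where triv: "fiber_bundle E \<pi> \<Lambda> F"
    using locally_trivial unfolding E_def \<pi>_def by blast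
  have metric: "riemannian_metric E g"
    unfolding g_def by (rule riemannian_metric_connection_metric[OF con p])
  have complement: "metric_complement E g u (vertical_space E \<pi> u) = natural_connection E h u"
    if "u \<in> E" for u
    unfolding g_def by (rule metric_complement_vertical[OF con p that])
  have base: "tangent_space \<Lambda> (\<pi> u) = UNIV" if "u \<in> E" for u
    using tangent_space_open[OF open_param] surj that by blast
  have onto: "\<pi> ` tangent_space E u = UNIV" if "u \<in> E" for u
    by (rule fiber_bundle_differential_onto[OF triv open_param p that])
  have iso: "linear_isometry_between (natural_connection E h u) (g u)
      (tangent_space \<Lambda> (\<pi> u)) (standard_metric (\<pi> u)) (frechet_derivative \<pi> (at u))"
    if "u \<in> E" for u
    using isometry_horizontal[OF con p that onto[OF that]]
    by (simp add: base[OF that] frechet_derivative_bounded_linear[OF p] g_def)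
  have "smooth_map_on E \<pi>" using triv unfolding fiber_bundle_def by blast
  then have "riemannian_submersion E g \<Lambda> standard_metric \<pi>"
    unfolding riemannian_submersion_def
    using metric riemannian_metric_standard surj complement iso onto base
    by (auto simp: frechet_derivative_bounded_linear[OF p])
  with metric iso complement show ?thesis
    by (simp add: submersion_connection_def)
qed

end
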